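(* Let $\mathcal{H}_A$ be a two-dimensional complex Hilbert space and $\mathcal{H}_B,\mathcal{H}_C$ finite-dimensional complex Hilbert spaces. For every pure state $|\psi\rangle\langle\psi|$ on $\mathcal{H}_A\otimes\mathcal{H}_B\otimes\mathcal{H}_C$, $$L_{A:CB}-L_{AC:B}\le L_{AB:C},$$ where $L_{A:CB}$, $L_{AC:B}$, $L_{AB:C}$ are the logarithmic negativities of the state with respect to the bipartitions $A|BC$, $AC|B$ and $AB|C$ respectively.
   Context: For a bipartite state $\rho_{XY}$ on $\mathcal{H}_X\otimes\mathcal{H}_Y$, the logarithmic negativity is $L_{X:Y}=\log_2\|\rho_{XY}^{T_X}\|_1=\log_2(2N_{X:Y}+1)$, where $\rho_{XY}^{T_X}$ is the partial transpose with respect to $X$, $\|\sigma\|_1=\mathrm{Tr}\sqrt{\sigma^\dagger\sigma}$ is the trace norm, and $N_{X:Y}=\frac{\|\rho_{XY}^{T_X}\|_1-1}{2}$ is the negativity. *)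

theory Defs
  imports "Jordan_Normal_Form.Jordan_Normal_Form"
begin

text \<open>Finite-dimensional complex Hilbert spaces are modelled as C^n with the
standard inner product; operators are complex n x n matrices.\<close>

definition adj :: "complex mat \<Rightarrow> complex mat" where
  "adj A = mat (dim_col A) (dim_row A) (\<lambda>(i,j). cnj (A $$ (j,i)))"

definition psd :: "nat \<Rightarrow> complex mat \<Rightarrow> bool" where
  "psd n M \<longleftrightarrow> M \<in> carrier_mat n n \<and> adj M = M \<and>
     (\<forall>v \<in> carrier_vec n. 0 \<le> Re (\<Sum>i<n. cnj (v $ i) * (mult_mat_vec M v) $ i))"

text \<open>Positive square root of a positive semidefinite matrix (unique).\<close>
definition psd_sqrt :: "complex mat \<Rightarrow> complex mat" where
  "psd_sqrt M = (THE S. psd (dim_row M) S \<and> S * S = M)"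

definition mtrace :: "complex mat \<Rightarrow> complex" where
  "mtrace A = (\<Sum>i<dim_row A. A $$ (i,i))"

definition trace_norm :: "complex mat \<Rightarrow> real" where
  "trace_norm s = Re (mtrace (psd_sqrt (adj s * s)))"

text \<open>Tripartite system A (dim 2), B (dim dB), C (dim dC); product basis
index (a,b,c) is encoded as a*dB*dC + b*dC + c.  Party 0 = A, 1 = B, 2 = C.\<close>
definition comp :: "nat \<Rightarrow> nat \<Rightarrow> nat \<Rightarrow> nat \<Rightarrow> nat" where
  "comp dB dC k i = (if k = 0 then i div (dB * dC)
                     else if k = 1 then (i div dC) mod dB else i mod dC)"

definition enc :: "nat \<Rightarrow> nat \<Rightarrow> (nat \<Rightarrow> nat) \<Rightarrow> nat" where
  "enc dB dC f = f 0 * dB * dC + f 1 * dC + f 2"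

definition ptrans :: "nat \<Rightarrow> nat \<Rightarrow> nat set \<Rightarrow> complex mat \<Rightarrow> complex mat" where
  "ptrans dB dC S \<rho> = mat (dim_row \<rho>) (dim_col \<rho>) (\<lambda>(i,j).
     \<rho> $$ (enc dB dC (\<lambda>k. if k \<in> S then comp dB dC k j else comp dB dC k i),
           enc dB dC (\<lambda>k. if k \<in> S then comp dB dC k i else comp dB dC k j)))"

definition log_neg :: "nat \<Rightarrow> nat \<Rightarrow> nat set \<Rightarrow> complex mat \<Rightarrow> real" where
  "log_neg dB dC X \<rho> = log 2 (trace_norm (ptrans dB dC X \<rho>))"

definition proj :: "complex vec \<Rightarrow> complex mat" where
  "proj \<psi> = mat (dim_vec \<psi>) (dim_vec \<psi>) (\<lambda>(i,j). \<psi> $ i * cnj (\<psi> $ j))"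

end

theory Submission
  imports Defs "Jordan_Normal_Form.Schur_Decomposition"
begin

text \<open>
  For a pure state with Schmidt coefficients \<open>s\<^sub>k\<close> across a bipartition, the trace norm of the partial
  transpose is \<open>(\<Sum> s\<^sub>k)\<^sup>2\<close>. Together with \<open>\<Sum> s\<^sub>k\<^sup>2 = 1\<close> this gives the lower bound
  \<open>1 + sqrt (2 (1 - P))\<close>, where \<open>P = \<Sum> s\<^sub>k\<^sup>4\<close> is the purity of the reduced state, with equality if there are
  at most two Schmidt coefficients, as for the qubit \<open>A\<close>. The linear entropy \<open>1 - P\<close> is subadditive,
  because \<open>\<langle>\<psi> \<otimes> \<psi>| (1 - F\<^sub>B) (1 - F\<^sub>C) |\<psi> \<otimes> \<psi>\<rangle> \<ge> 0\<close> for the flips \<open>F\<^sub>B\<close>, \<open>F\<^sub>C\<close> exchanging the two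
  copies of \<open>B\<close>, respectively \<open>C\<close>. Hence \<open>1 + sqrt (2 (1 - P\<^sub>A)) \<le> (1 + sqrt (2 (1 - P\<^sub>B))) (1 + sqrt (2 (1 - P\<^sub>C)))\<close>,
  which is the claim after taking logarithms.
\<close>

section \<open>Diagonalisation of Hermitian forms\<close>

text \<open>Vectors of \<open>C^n\<close> are plain functions of which only the values below
  \<open>n\<close> count.\<close>

definition cip :: "nat \<Rightarrow> (nat \<Rightarrow> complex) \<Rightarrow> (nat \<Rightarrow> complex) \<Rightarrow> complex" where
  "cip n u v = (\<Sum>x<n. cnj (u x) * v x)"

definition mapp :: "nat \<Rightarrow> (nat \<Rightarrow> nat \<Rightarrow> complex) \<Rightarrow> (nat \<Rightarrow> complex) \<Rightarrow> nat \<Rightarrow> complex" where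
  "mapp n h u x = (\<Sum>y<n. h x y * u y)"

lemma cip_cong: "(\<And>x. x < n \<Longrightarrow> u x = u' x) \<Longrightarrow> (\<And>x. x < n \<Longrightarrow> v x = v' x) \<Longrightarrow> cip n u v = cip n u' v'"
  unfolding cip_def by (intro sum.cong) auto

lemma mapp_cong: "(\<And>x. x < n \<Longrightarrow> u x = u' x) \<Longrightarrow> mapp n h u x = mapp n h u' x"
  unfolding mapp_def by (intro sum.cong) auto

lemma cip_cnj: "cnj (cip n u v) = cip n v u"
  unfolding cip_def by (simp add: mult.commute)

lemma cip_add_right: "cip n u (\<lambda>x. v x + w x) = cip n u v + cip n u w"
  unfolding cip_def by (simp add: distrib_left sum.distrib)

lemma cip_diff_right: "cip n u (\<lambda>x. v x - w x) = cip n u v - cip n u w"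
  unfolding cip_def by (simp add: right_diff_distrib sum_subtractf)

lemma cip_scale_right: "cip n u (\<lambda>x. c * v x) = c * cip n u v"
  unfolding cip_def by (simp add: sum_distrib_left ac_simps)

lemma cip_scale_left: "cip n (\<lambda>x. c * u x) v = cnj c * cip n u v"
  unfolding cip_def by (simp add: sum_distrib_left ac_simps)

lemma cip_sum_right: "cip n u (\<lambda>x. \<Sum>i\<in>I. v i x) = (\<Sum>i\<in>I. cip n u (v i))"
  unfolding cip_def by (simp add: sum_distrib_left sum.swap[of _ _ I])

lemma cip_self: "cip n u u = of_real (\<Sum>x<n. (cmod (u x))\<^sup>2)"
  unfolding cip_def by (simp add: complex_norm_square[unfolded of_real_power] mult.commute)

lemma cip_self_eq_0_iff: "cip n u u = 0 \<longleftrightarrow> (\<forall>x<n. u x = 0)"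
  unfolding cip_self of_real_eq_0_iff by (subst sum_nonneg_eq_0_iff) auto

lemma mapp_diff: "mapp n h (\<lambda>x. v x - w x) x = mapp n h v x - mapp n h w x"
  unfolding mapp_def by (simp add: right_diff_distrib sum_subtractf)

lemma mapp_scale: "mapp n h (\<lambda>x. c * v x) x = c * mapp n h v x"
  unfolding mapp_def by (simp add: sum_distrib_left ac_simps)

lemma mapp_sum: "mapp n h (\<lambda>x. \<Sum>i\<in>I. v i x) x = (\<Sum>i\<in>I. mapp n h (v i) x)"
  unfolding mapp_def by (simp add: sum_distrib_left sum.swap[of _ _ I])

lemma cip_mapp_hermitian:
  assumes "\<And>x y. x < n \<Longrightarrow> y < n \<Longrightarrow> h x y = cnj (h y x)"
  shows "cip n u (mapp n h v) = cip n (mapp n h u) v"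
proof -
  have "cip n u (mapp n h v) = (\<Sum>x<n. \<Sum>y<n. cnj (u x) * (h x y * v y))"
    unfolding cip_def mapp_def by (simp add: sum_distrib_left)
  also have "\<dots> = (\<Sum>x<n. \<Sum>y<n. cnj (h y x * u x) * v y)"
  proof (intro sum.cong refl)
    fix x y assume "x \<in> {..<n}" "y \<in> {..<n}"
    then have "cnj (h y x) = h x y" by (intro assms[symmetric]) auto
    then show "cnj (u x) * (h x y * v y) = cnj (h y x * u x) * v y" by simp
  qed
  also have "\<dots> = (\<Sum>y<n. \<Sum>x<n. cnj (h y x * u x) * v y)" by (rule sum.swap)
  also have "\<dots> = cip n (mapp n h u) v"
    unfolding cip_def mapp_def by (simp add: sum_distrib_right)
  finally show ?thesis .
qed

text \<open>The vectors \<open>q k\<close> may vanish. This spares the Gram-Schmidt process a linear independence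
  argument, and completeness of the system makes up for it.\<close>
definition eigensystem ::
  "nat \<Rightarrow> (nat \<Rightarrow> nat \<Rightarrow> complex) \<Rightarrow> nat \<Rightarrow> (nat \<Rightarrow> nat \<Rightarrow> complex) \<Rightarrow> (nat \<Rightarrow> complex) \<Rightarrow> bool" where
  "eigensystem n h m q l \<longleftrightarrow>
    (\<forall>k<m. \<forall>x<n. mapp n h (q k) x = l k * q k x) \<and>
    (\<forall>j<m. \<forall>k<m. j \<noteq> k \<longrightarrow> cip n (q j) (q k) = 0) \<and>
    (\<forall>k<m. cip n (q k) (q k) = 1 \<or> (\<forall>x<n. q k x = 0))"

lemma eigensystemD:
  assumes "eigensystem n h m q l"
  shows "k < m \<Longrightarrow> x < n \<Longrightarrow> mapp n h (q k) x = l k * q k x"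
    and "j < m \<Longrightarrow> k < m \<Longrightarrow> j \<noteq> k \<Longrightarrow> cip n (q j) (q k) = 0"
    and "k < m \<Longrightarrow> cip n (q k) (q k) = 1 \<or> (\<forall>x<n. q k x = 0)"
  using assms unfolding eigensystem_def by simp_all

text \<open>Gram-Schmidt applied to a triangularising sequence already diagonalises. The image of
  the residual \<open>w\<close> of \<open>p m\<close> is a multiple of \<open>w\<close> plus a
  combination of the earlier \<open>q j\<close>, and that combination vanishes because a Hermitian
  \<open>h\<close> preserves the orthogonal complement of the eigenvectors \<open>q j\<close>. The
  last clause keeps every \<open>p k\<close> in the span of the \<open>q i\<close>.\<close>

lemma hermitian_gram_schmidt:
  fixes n m :: nat
  assumes herm: "\<And>x y. x < n \<Longrightarrow> y < n \<Longrightarrow> h x y = cnj (h y x)"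
    and tri: "\<And>k x. k < m \<Longrightarrow> x < n \<Longrightarrow> mapp n h (p k) x = (\<Sum>i\<le>k. b i k * p i x)"
  shows "\<exists>q l. eigensystem n h m q l \<and>
    (\<forall>k<m. \<forall>x<n. (\<Sum>i<m. cip n (q i) (p k) * q i x) = p k x)"
  using tri
proof (induction m)
  case 0
  then show ?case by (auto simp: eigensystem_def)
next
  case (Suc m)
  have "\<exists>q l. eigensystem n h m q l \<and>
    (\<forall>k<m. \<forall>x<n. (\<Sum>i<m. cip n (q i) (p k) * q i x) = p k x)"
    by (rule Suc.IH) (use Suc.prems in auto)
  then obtain q l where
      es: "eigensystem n h m q l"
    and spn: "\<And>k x. k < m \<Longrightarrow> x < n \<Longrightarrow> (\<Sum>i<m. cip n (q i) (p k) * q i x) = p k x"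
    by auto
  note ev = eigensystemD(1)[OF es] and orth = eigensystemD(2)[OF es] and nrm = eigensystemD(3)[OF es]
  have cip_comb: "cip n (q j) (\<lambda>x. \<Sum>i<m. d i * q i x) = d j * cip n (q j) (q j)" if "j < m" for j d
  proof -
    have "cip n (q j) (\<lambda>x. \<Sum>i<m. d i * q i x) = (\<Sum>i<m. if i = j then d j * cip n (q j) (q j) else 0)"
      unfolding cip_sum_right cip_scale_right
      by (intro sum.cong) (use orth that in auto)
    then show ?thesis using that by simp
  qed
  define c where "c i = cip n (q i) (p m)" for i
  define w where "w x = p m x - (\<Sum>i<m. c i * q i x)" for x
  have qw: "cip n (q j) w = 0" if "j < m" for j
  proof -
    have "cip n (q j) w = c j - c j * cip n (q j) (q j)"
      unfolding w_def cip_diff_right cip_comb[OF that] c_def by simp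
    \<comment> \<open>This settles the alternative in which \<open>q j\<close> does not have norm
      1.\<close>
    moreover have "c j = 0" if "\<forall>x<n. q j x = 0"
      using that unfolding c_def cip_def by simp
    ultimately show ?thesis using nrm[OF that] by auto
  qed
  \<comment> \<open>The coefficient of \<open>q j\<close> in the image of \<open>w\<close>: expand
    each \<open>p i\<close> with \<open>i < m\<close> in the \<open>q j\<close>, write
    \<open>p m\<close> as \<open>w\<close> plus its projection, and subtract the image of that
    projection.\<close>
  define d where "d j = (\<Sum>i<m. b i m * cip n (q j) (p i)) + b m m * c j - c j * l j" for j
  have hw: "mapp n h w x = b m m * w x + (\<Sum>j<m. d j * q j x)" if x: "x < n" for x
  proof -
    have "mapp n h w x = mapp n h (p m) x - (\<Sum>i<m. c i * mapp n h (q i) x)"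
      unfolding w_def mapp_diff mapp_sum mapp_scale by simp
    also have "mapp n h (p m) x = (\<Sum>i<m. b i m * p i x) + b m m * p m x"
      using Suc.prems[of m x] x by (simp add: lessThan_Suc_atMost[symmetric])
    also have "(\<Sum>i<m. b i m * p i x) = (\<Sum>i<m. \<Sum>j<m. b i m * cip n (q j) (p i) * q j x)"
      using x by (intro sum.cong refl) (simp add: sum_distrib_left mult.assoc flip: spn)
    also have "\<dots> = (\<Sum>j<m. \<Sum>i<m. b i m * cip n (q j) (p i) * q j x)" by (rule sum.swap)
    also have "\<dots> = (\<Sum>j<m. (\<Sum>i<m. b i m * cip n (q j) (p i)) * q j x)"
      by (simp add: sum_distrib_right)
    also have "(\<Sum>i<m. c i * mapp n h (q i) x) = (\<Sum>i<m. c i * l i * q i x)"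
      using ev x by (intro sum.cong) auto
    also have "b m m * p m x = b m m * w x + (\<Sum>i<m. b m m * c i * q i x)"
      unfolding w_def by (simp add: algebra_simps sum_distrib_left)
    finally show ?thesis unfolding d_def
      by (simp add: algebra_simps sum.distrib sum_subtractf)
  qed
  \<comment> \<open>Moving \<open>h\<close> onto the eigenvector \<open>q j\<close>, which is
    orthogonal to \<open>w\<close>, shows \<open>d j = 0\<close> unless \<open>q j\<close>
    vanishes.\<close>
  have dq: "d j * q j x = 0" if j: "j < m" and x: "x < n" for j x
  proof -
    have "cip n (q j) (mapp n h w) = cip n (mapp n h (q j)) w"
      by (rule cip_mapp_hermitian) (rule herm)
    also have "\<dots> = cip n (\<lambda>x. l j * q j x) w" using ev j by (intro cip_cong) auto
    also have "\<dots> = 0" using qw[OF j] by (simp add: cip_scale_left)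
    finally have "cip n (q j) (mapp n h w) = 0" .
    moreover have "cip n (q j) (mapp n h w) = cip n (q j) (\<lambda>x. b m m * w x + (\<Sum>j<m. d j * q j x))"
      using hw by (intro cip_cong) auto
    moreover have "\<dots> = d j * cip n (q j) (q j)"
      unfolding cip_add_right cip_scale_right cip_comb[OF j] using qw[OF j] by simp
    ultimately have "d j * cip n (q j) (q j) = 0" by simp
    then show ?thesis using nrm[OF j] x by auto
  qed
  have hw': "mapp n h w x = b m m * w x" if x: "x < n" for x
    using hw[OF x] dq x by simp
  \<comment> \<open>If \<open>w\<close> vanishes, division by zero gives \<open>r = 0\<close>, and
    the new vector is the zero vector that \<open>eigensystem\<close> allows.\<close>
  define r where "r = complex_of_real (1 / sqrt (\<Sum>x<n. (cmod (w x))\<^sup>2))"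
  define q' where "q' k = (if k = m then (\<lambda>x. r * w x) else q k)" for k
  define l' where "l' k = (if k = m then b m m else l k)" for k
  have q'[simp]: "q' m = (\<lambda>x. r * w x)" "\<And>k. k < m \<Longrightarrow> q' k = q k" by (auto simp: q'_def)
  have l'[simp]: "l' m = b m m" "\<And>k. k < m \<Longrightarrow> l' k = l k" by (auto simp: l'_def)
  have wq: "cip n w (q j) = 0" if "j < m" for j
    using qw[OF that] cip_cnj[of n "q j" w] by simp
  have rw: "r * cnj r * cip n w w = 1 \<or> (\<forall>x<n. w x = 0)"
  proof (cases "cip n w w = 0")
    case True
    then show ?thesis by (simp add: cip_self_eq_0_iff)
  next
    case False
    define s where "s = (\<Sum>x<n. (cmod (w x))\<^sup>2)"
    have "s \<ge> 0" unfolding s_def by (simp add: sum_nonneg)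
    moreover have "s \<noteq> 0" using False unfolding cip_self s_def of_real_eq_0_iff .
    ultimately have "s > 0" by simp
    then have "1 / sqrt s * (1 / sqrt s) * s = 1" by (simp add: field_simps)
    then have "complex_of_real (1 / sqrt s * (1 / sqrt s) * s) = 1" by (simp only: of_real_1)
    then show ?thesis unfolding cip_self r_def s_def[symmetric]
      by (simp only: of_real_mult complex_cnj_complex_of_real simp_thms)
  qed
  have "(\<forall>k<Suc m. \<forall>x<n. mapp n h (q' k) x = l' k * q' k x)"
    using ev hw' by (auto simp: less_Suc_eq mapp_scale)
  moreover have "(\<forall>j<Suc m. \<forall>k<Suc m. j \<noteq> k \<longrightarrow> cip n (q' j) (q' k) = 0)"
    using orth qw wq by (auto simp: less_Suc_eq cip_scale_left cip_scale_right)
  moreover have "(\<forall>k<Suc m. cip n (q' k) (q' k) = 1 \<or> (\<forall>x<n. q' k x = 0))"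
    using nrm rw by (auto simp: less_Suc_eq cip_scale_left cip_scale_right mult.assoc mult.left_commute)
  moreover have "(\<Sum>i<Suc m. cip n (q' i) (p k) * q' i x) = p k x" if k: "k < Suc m" and x: "x < n" for k x
  proof (cases "k = m")
    case True
    have "cip n w (\<lambda>x. \<Sum>i<m. c i * q i x) = 0"
      unfolding cip_sum_right cip_scale_right using wq by simp
    moreover have "cip n w (p m) = cip n w (\<lambda>x. w x + (\<Sum>i<m. c i * q i x))"
      unfolding w_def by (intro cip_cong) auto
    ultimately have "cip n w (p m) = cip n w w" by (simp add: cip_add_right)
    then have "cip n (q' m) (p m) * q' m x = (r * cnj r * cip n w w) * w x"
      by (simp add: cip_scale_left ac_simps)
    also have "\<dots> = w x" using rw x by auto
    finally have last: "cip n (q' m) (p m) * q' m x = w x" .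
    have "(\<Sum>i<Suc m. cip n (q' i) (p m) * q' i x) = (\<Sum>i<m. c i * q i x) + w x"
      unfolding sum.lessThan_Suc last by (simp add: c_def)
    then show ?thesis using True by (simp add: w_def)
  next
    case False
    with k have k: "k < m" by simp
    have "cip n w (p k) = cip n w (\<lambda>x. \<Sum>i<m. cip n (q i) (p k) * q i x)"
      using spn k by (intro cip_cong) auto
    also have "\<dots> = 0" unfolding cip_sum_right cip_scale_right using wq by simp
    finally show ?thesis using spn[OF k x] by (simp add: cip_scale_left)
  qed
  ultimately have "eigensystem n h (Suc m) q' l'"
      "\<forall>k<Suc m. \<forall>x<n. (\<Sum>i<Suc m. cip n (q' i) (p k) * q' i x) = p k x"
    unfolding eigensystem_def by auto
  then show ?case by (intro exI conjI)
qed

text \<open>Schur decomposition gives \<open>H * P = P * B\<close> with \<open>B\<close> upper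
  triangular, so the columns of \<open>P\<close> satisfy the premise of
  \<open>hermitian_gram_schmidt\<close>. As \<open>P\<close> is invertible, its columns span the
  space, hence so do the \<open>q k\<close>; the second conclusion is this completeness as a
  resolution of the identity.\<close>

lemma hermitian_eigenbasis:
  fixes n :: nat
  assumes herm: "\<And>x y. x < n \<Longrightarrow> y < n \<Longrightarrow> h x y = cnj (h y x)"
  obtains q l where
      "eigensystem n h n q l"
    and "\<And>x y. x < n \<Longrightarrow> y < n \<Longrightarrow> (\<Sum>k<n. q k x * cnj (q k y)) = (if x = y then 1 else 0)"
proof -
  define H where "H = mat n n (\<lambda>(x, y). h x y)"
  have H: "H \<in> carrier_mat n n" by (simp add: H_def)
  obtain es where es: "char_poly H = (\<Prod>a\<leftarrow>es. [:- a, 1:])"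
    using char_poly_factorized[OF H] by auto
  obtain B P Q where "schur_decomposition H es = (B, P, Q)" by (cases "schur_decomposition H es") auto
  from schur_decomposition[OF H es this] have sim: "similar_mat_wit H B P Q" and ut: "upper_triangular B" by auto
  from similar_mat_witD2[OF H sim] have B: "B \<in> carrier_mat n n" and P: "P \<in> carrier_mat n n"
    and Q: "Q \<in> carrier_mat n n" and PQ: "P * Q = 1\<^sub>m n" and QP: "Q * P = 1\<^sub>m n" and HPBQ: "H = P * B * Q" by auto
  have "H * P = P * B * (Q * P)" unfolding HPBQ using P B Q by (simp add: assoc_mult_mat[of _ n n _ n _ n])
  then have HP: "H * P = P * B" using QP P B by simp
  define p where "p k x = P $$ (x, k)" for k x
  have tri: "mapp n h (p k) x = (\<Sum>i\<le>k. B $$ (i, k) * p i x)" if k: "k < n" and x: "x < n" for k x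
  proof -
    have "mapp n h (p k) x = (H * P) $$ (x, k)"
      using k x P unfolding mapp_def p_def H_def by (simp add: scalar_prod_def lessThan_atLeast0)
    also have "\<dots> = (\<Sum>i<n. B $$ (i, k) * p i x)"
      unfolding HP using k x P B by (simp add: scalar_prod_def p_def mult.commute lessThan_atLeast0)
    also have "\<dots> = (\<Sum>i\<le>k. B $$ (i, k) * p i x)"
      using k B ut by (intro sum.mono_neutral_right) (auto simp: upper_triangular_def)
    finally show ?thesis .
  qed
  have "\<exists>q l. eigensystem n h n q l \<and>
    (\<forall>k<n. \<forall>x<n. (\<Sum>i<n. cip n (q i) (p k) * q i x) = p k x)"
    by (rule hermitian_gram_schmidt[where b = "\<lambda>i k. B $$ (i, k)"]) (fact herm, fact tri)
  then obtain q l where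
      sys: "eigensystem n h n q l"
    and spn: "\<And>k x. k < n \<Longrightarrow> x < n \<Longrightarrow> (\<Sum>i<n. cip n (q i) (p k) * q i x) = p k x"
    by auto
  have pq: "(\<Sum>k<n. p k x * Q $$ (k, y)) = (if x = y then 1 else 0)" if "x < n" "y < n" for x y
  proof -
    have "(\<Sum>k<n. p k x * Q $$ (k, y)) = (P * Q) $$ (x, y)"
      using that P Q by (simp add: scalar_prod_def p_def lessThan_atLeast0)
    then show ?thesis using that PQ by simp
  qed
  have "(\<Sum>k<n. q k x * cnj (q k y)) = (if x = y then 1 else 0)" if x: "x < n" and y: "y < n" for x y
  proof -
    \<comment> \<open>An entry of \<open>P * Q = 1\<close> with each column of \<open>P\<close>
      expanded in the \<open>q i\<close>; the sum over \<open>k\<close> then collapses inside the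
      inner product.\<close>
    have "(if x = y then 1 else 0) = (\<Sum>k<n. (\<Sum>i<n. cip n (q i) (p k) * q i x) * Q $$ (k, y))"
      unfolding pq[OF x y, symmetric] using spn x by (intro sum.cong) auto
    also have "\<dots> = (\<Sum>k<n. \<Sum>i<n. q i x * (cip n (q i) (p k) * Q $$ (k, y)))"
      by (simp add: sum_distrib_left sum_distrib_right ac_simps)
    also have "\<dots> = (\<Sum>i<n. \<Sum>k<n. q i x * (cip n (q i) (p k) * Q $$ (k, y)))" by (rule sum.swap)
    also have "\<dots> = (\<Sum>i<n. q i x * cip n (q i) (\<lambda>z. \<Sum>k<n. p k z * Q $$ (k, y)))"
      by (simp add: cip_sum_right sum_distrib_left mult.commute[of "p _ _"] cip_scale_right mult.commute[of "cip _ _ _"])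
    also have "\<dots> = (\<Sum>i<n. q i x * cip n (q i) (\<lambda>z. if z = y then 1 else 0))"
      using pq y by (intro sum.cong refl arg_cong2[where f="(*)"] cip_cong) auto
    also have "\<dots> = (\<Sum>i<n. q i x * cnj (q i y))"
      using y by (simp add: cip_def if_distrib[of "(*) _"] cong: if_cong)
    finally show ?thesis by simp
  qed
  with sys show thesis by (rule that)
qed

section \<open>Positive square roots and Schmidt decomposition\<close>

text \<open>Translates \<open>psd\<close> into the function notation for vectors, to which the
  eigensystem lemmas apply.\<close>

lemma psd_iff:
  "psd n M \<longleftrightarrow> M \<in> carrier_mat n n \<and> (\<forall>i<n. \<forall>j<n. M $$ (i, j) = cnj (M $$ (j, i))) \<and>
    (\<forall>v. 0 \<le> Re (cip n v (mapp n (\<lambda>i j. M $$ (i, j)) v)))"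
proof (cases "M \<in> carrier_mat n n")
  case True
  have "adj M = M \<longleftrightarrow> (\<forall>i<n. \<forall>j<n. M $$ (i, j) = cnj (M $$ (j, i)))"
    (is "_ \<longleftrightarrow> ?H")
  proof
    have entry: "adj M $$ (i, j) = cnj (M $$ (j, i))" if "i < n" "j < n" for i j
      using True that by (simp add: adj_def)
    {
      assume "adj M = M"
      then show ?H using entry by metis
    next
      assume ?H
      with entry have "adj M $$ (i, j) = M $$ (i, j)" if "i < n" "j < n" for i j
        using that by metis
      then show "adj M = M" using True by (intro eq_matI) (auto simp: adj_def)
    }
  qed
  moreover have form: "(\<Sum>i<n. cnj (v $ i) * (M *\<^sub>v v) $ i) = cip n (($) v) (mapp n (\<lambda>i j. M $$ (i, j)) (($) v))"
    if "v \<in> carrier_vec n" for v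
    using True that unfolding cip_def mapp_def
    by (intro sum.cong refl) (auto simp: scalar_prod_def lessThan_atLeast0)
  moreover have "(\<forall>v \<in> carrier_vec n. 0 \<le> Re (\<Sum>i<n. cnj (v $ i) * (M *\<^sub>v v) $ i)) \<longleftrightarrow>
    (\<forall>v. 0 \<le> Re (cip n v (mapp n (\<lambda>i j. M $$ (i, j)) v)))" (is "?L \<longleftrightarrow> ?R")
  proof
    assume L: ?L
    show ?R
    proof
      fix v
      have "cip n v (mapp n (\<lambda>i j. M $$ (i, j)) v) =
        cip n (($) (vec n v)) (mapp n (\<lambda>i j. M $$ (i, j)) (($) (vec n v)))"
        by (intro cip_cong mapp_cong) auto
      then show "0 \<le> Re (cip n v (mapp n (\<lambda>i j. M $$ (i, j)) v))"
        using L form[of "vec n v"] by (metis vec_carrier)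
    qed
  next
    assume ?R
    then show ?L using form by simp
  qed
  ultimately show ?thesis using True unfolding psd_def by simp
qed (simp add: psd_def)

lemma mapp_mapp_mult:
  assumes "M \<in> carrier_mat n n" "x < n"
  shows "mapp n (\<lambda>i j. M $$ (i, j)) (mapp n (\<lambda>i j. M $$ (i, j)) v) x = mapp n (\<lambda>i j. (M * M) $$ (i, j)) v x"
proof -
  have "mapp n (\<lambda>i j. M $$ (i, j)) (mapp n (\<lambda>i j. M $$ (i, j)) v) x =
    (\<Sum>y<n. \<Sum>z<n. M $$ (x, y) * M $$ (y, z) * v z)"
    unfolding mapp_def by (simp add: sum_distrib_left mult.assoc)
  also have "\<dots> = (\<Sum>z<n. \<Sum>y<n. M $$ (x, y) * M $$ (y, z) * v z)" by (rule sum.swap)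
  also have "\<dots> = mapp n (\<lambda>i j. (M * M) $$ (i, j)) v x"
    using assms unfolding mapp_def
    by (intro sum.cong refl) (auto simp: scalar_prod_def lessThan_atLeast0 sum_distrib_right)
  finally show ?thesis .
qed

text \<open>Every eigenvector \<open>v\<close> of \<open>S - T\<close>, with eigenvalue \<open>l\<close>, satisfies
  \<open>cnj l * \<langle>v, S v\<rangle> + l * \<langle>v, T v\<rangle> = 0\<close> because \<open>S\<^sup>2 = T\<^sup>2\<close>; as \<open>l\<close> is real this forces \<open>l = 0\<close>.\<close>
lemma psd_square_inject:
  assumes S: "psd n S" and T: "psd n T" and eq: "S * S = T * T"
  shows "S = T"
proof -
  let ?S = "\<lambda>i j. S $$ (i, j)" and ?T = "\<lambda>i j. T $$ (i, j)"
  from S have cS: "S \<in> carrier_mat n n" and hS: "\<And>i j. i < n \<Longrightarrow> j < n \<Longrightarrow> ?S i j = cnj (?S j i)"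
    and pS: "\<And>v. 0 \<le> Re (cip n v (mapp n ?S v))" unfolding psd_iff by blast+
  from T have cT: "T \<in> carrier_mat n n" and hT: "\<And>i j. i < n \<Longrightarrow> j < n \<Longrightarrow> ?T i j = cnj (?T j i)"
    and pT: "\<And>v. 0 \<le> Re (cip n v (mapp n ?T v))" unfolding psd_iff by blast+
  define D where "D i j = ?S i j - ?T i j" for i j
  have hD: "D i j = cnj (D j i)" if "i < n" "j < n" for i j
    unfolding D_def complex_cnj_diff using hS[OF that] hT[OF that] by argo
  obtain q l where es: "eigensystem n D n q l"
    and complete: "\<And>x y. x < n \<Longrightarrow> y < n \<Longrightarrow> (\<Sum>k<n. q k x * cnj (q k y)) = (if x = y then 1 else 0)"
    using hermitian_eigenbasis[of n D] hD by blast
  \<comment> \<open>By completeness it suffices that \<open>S - T\<close> annihilates every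
    \<open>q k\<close>.\<close>
  have Dq: "mapp n D (q k) x = 0" if k: "k < n" and x: "x < n" for k x
  proof -
    define v where "v = q k"
    define a where "a = mapp n ?S v"
    define b where "b = mapp n ?T v"
    have "mapp n D v x = a x - b x" for x
      unfolding a_def b_def mapp_def D_def by (simp add: left_diff_distrib sum_subtractf)
    then have ab: "a x = b x + l k * v x" if "x < n" for x
      using eigensystemD(1)[OF es k that] unfolding v_def by (metis add_diff_cancel_left' diff_add_cancel add.commute)
    have real_form: "cip n u (mapp n h u) \<in> \<real>" if "\<And>i j. i < n \<Longrightarrow> j < n \<Longrightarrow> h i j = cnj (h j i)" for u h
    proof -
      have "cip n u (mapp n h u) = cip n (mapp n h u) u"
        by (rule cip_mapp_hermitian) (rule that)
      then show ?thesis using cip_cnj[of n u "mapp n h u"] by (simp add: Reals_cnj_iff)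
    qed
    \<comment> \<open>Both norms are the value at \<open>v\<close> of the quadratic form of the
      common square.\<close>
    have "cip n a a = cip n v (mapp n ?S a)"
      unfolding a_def by (rule cip_mapp_hermitian[symmetric]) (rule hS)
    also have "\<dots> = cip n v (mapp n ?T b)"
      unfolding a_def b_def by (intro cip_cong) (simp_all add: mapp_mapp_mult cS cT eq)
    also have "\<dots> = cip n b b"
      unfolding b_def by (rule cip_mapp_hermitian) (rule hT)
    finally have aa_bb: "cip n a a = cip n b b" .
    have "cip n u a = cip n u (\<lambda>x. b x + l k * v x)" for u
      using ab by (intro cip_cong) auto
    then have cip_a: "cip n u a = cip n u b + l k * cip n u v" for u
      by (simp add: cip_add_right cip_scale_right)
    \<comment> \<open>Replace \<open>a\<close> by \<open>b + l k * v\<close>, first in the right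
      slot and then in the left one.\<close>
    have "cip n a a = cip n a b + l k * cip n a v" by (rule cip_a)
    also have "cip n a b = cnj (cip n b a)" by (simp add: cip_cnj)
    also have "\<dots> = cip n b b + cnj (l k) * cip n v b"
      unfolding cip_a by (simp add: cip_cnj)
    finally have zero: "cnj (l k) * cip n v b + l k * cip n a v = 0" using aa_bb by simp
    have va: "cip n v a \<in> \<real>" unfolding a_def using hS by (rule real_form)
    have vb: "cip n v b \<in> \<real>" unfolding b_def using hT by (rule real_form)
    have av: "cip n a v = cip n v a" using va cip_cnj[of n v a] by (simp add: Reals_cnj_iff)
    have "cip n v v = 1 \<or> (\<forall>x<n. v x = 0)" using eigensystemD(3)[OF es k] by (simp add: v_def)
    then show ?thesis
    proof
      assume "cip n v v = 1"
      then have lk: "l k = cip n v a - cip n v b" using cip_a[of v] by simp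
      then have "cnj (l k) = l k" using va vb by (simp add: Reals_cnj_iff)
      with zero av have "l k * (cip n v a + cip n v b) = 0"
        by (simp add: algebra_simps)
      then have "(cip n v a - cip n v b) * (cip n v a + cip n v b) = 0"
        unfolding lk .
      moreover have "0 \<le> Re (cip n v a)" "0 \<le> Re (cip n v b)" unfolding a_def b_def by (rule pS pT)+
      \<comment> \<open>Either the two values agree or their sum is zero; in the latter case both
        vanish, being nonnegative reals.\<close>
      ultimately have "cip n v a = cip n v b"
        using va vb by (auto simp: complex_eq_iff complex_is_Real_iff)
      then show ?thesis using lk eigensystemD(1)[OF es k x] by simp
    next
      assume "\<forall>x<n. v x = 0"
      then show ?thesis unfolding v_def mapp_def by simp
    qed
  qed
  have "D x y = 0" if x: "x < n" and y: "y < n" for x y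
  proof -
    have "D x y = (\<Sum>z<n. D x z * (if z = y then 1 else 0))"
      using y by (simp add: if_distrib[of "(*) _"] cong: if_cong)
    also have "\<dots> = (\<Sum>z<n. \<Sum>k<n. D x z * q k z * cnj (q k y))"
      using y by (intro sum.cong refl) (simp add: sum_distrib_left mult.assoc flip: complete)
    also have "\<dots> = (\<Sum>k<n. \<Sum>z<n. D x z * q k z * cnj (q k y))" by (rule sum.swap)
    also have "\<dots> = (\<Sum>k<n. mapp n D (q k) x * cnj (q k y))"
      unfolding mapp_def by (simp add: sum_distrib_right)
    also have "\<dots> = 0" using Dq x by simp
    finally show ?thesis .
  qed
  then show ?thesis using cS cT unfolding D_def by (intro eq_matI) auto
qed

text \<open>\<open>psd_sqrt\<close> is a definite description, so uniqueness turns any exhibited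
  positive square root into its value.\<close>

lemma trace_norm_eqI:
  assumes "dim_col \<sigma> = n" and "psd n S" and "S * S = adj \<sigma> * \<sigma>"
  shows "trace_norm \<sigma> = Re (mtrace S)"
proof -
  have "dim_row (adj \<sigma> * \<sigma>) = n" using assms(1) by (simp add: adj_def)
  then have "psd_sqrt (adj \<sigma> * \<sigma>) = S"
    unfolding psd_sqrt_def using assms(2,3) psd_square_inject[of n] by (intro the_equality) auto
  then show ?thesis by (simp add: trace_norm_def)
qed

text \<open>The \<open>q k\<close> diagonalise \<open>h\<close>, the reduced operator of
  \<open>\<phi>\<close> on the first factor, and \<open>w k\<close> is the component of
  \<open>\<phi>\<close> along \<open>q k\<close>. Since
  \<open><w j, w k> = <q k, h (q j)> = l j * <q k, q j>\<close>, distinct components are orthogonal,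
  and their norms are the Schmidt coefficients.\<close>

lemma schmidt_decomposition:
  fixes n m :: nat
  obtains K and s :: "nat \<Rightarrow> real" and q v where
      "K \<subseteq> {..<n}" and "\<And>k. k \<in> K \<Longrightarrow> 0 < s k"
    and "\<And>j k. j \<in> K \<Longrightarrow> k \<in> K \<Longrightarrow> cip n (q j) (q k) = (if j = k then 1 else 0)"
    and "\<And>j k. j \<in> K \<Longrightarrow> k \<in> K \<Longrightarrow> cip m (v j) (v k) = (if j = k then 1 else 0)"
    and "\<And>x y. x < n \<Longrightarrow> y < m \<Longrightarrow> \<phi> x y = (\<Sum>k\<in>K. of_real (s k) * q k x * v k y)"
proof -
  define h where "h x x' = (\<Sum>y<m. \<phi> x y * cnj (\<phi> x' y))" for x x'
  have "h x x' = cnj (h x' x)" for x x' unfolding h_def by (simp add: mult.commute)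
  then obtain q l where es: "eigensystem n h n q l"
    and complete: "\<And>x y. x < n \<Longrightarrow> y < n \<Longrightarrow> (\<Sum>k<n. q k x * cnj (q k y)) = (if x = y then 1 else 0)"
    using hermitian_eigenbasis[of n h] by blast
  define w where "w k y = (\<Sum>x<n. cnj (q k x) * \<phi> x y)" for k y
  define s where "s k = sqrt (\<Sum>y<m. (cmod (w k y))\<^sup>2)" for k
  \<comment> \<open>Discarding \<open>s k = 0\<close> also removes the vanishing \<open>q k\<close>,
    and it keeps the division in \<open>v\<close> meaningful.\<close>
  define K where "K = {k. k < n \<and> s k \<noteq> 0}"
  define v where "v k y = of_real (1 / s k) * w k y" for k y
  have s_nonneg: "0 \<le> s k" for k unfolding s_def by (simp add: sum_nonneg)
  have ww: "cip m (w k) (w k) = of_real ((s k)\<^sup>2)" for k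
    unfolding cip_self s_def by (simp add: sum_nonneg)
  have w0: "w k y = 0" if "s k = 0" "y < m" for k y
    using cip_self_eq_0_iff[of m "w k"] ww[of k] that by simp
  have "cip m (w j) (w k) = cip n (q k) (mapp n h (q j))" for j k
  proof -
    have "cip m (w j) (w k) = (\<Sum>y<m. \<Sum>x<n. \<Sum>x'<n. q j x * cnj (\<phi> x y) * (cnj (q k x') * \<phi> x' y))"
      unfolding cip_def w_def by (simp add: sum_product)
    also have "\<dots> = (\<Sum>x<n. \<Sum>y<m. \<Sum>x'<n. q j x * cnj (\<phi> x y) * (cnj (q k x') * \<phi> x' y))"
      by (rule sum.swap)
    also have "\<dots> = (\<Sum>x<n. \<Sum>x'<n. \<Sum>y<m. q j x * cnj (\<phi> x y) * (cnj (q k x') * \<phi> x' y))"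
      by (intro sum.cong refl sum.swap)
    also have "\<dots> = (\<Sum>x'<n. \<Sum>x<n. \<Sum>y<m. q j x * cnj (\<phi> x y) * (cnj (q k x') * \<phi> x' y))"
      by (rule sum.swap)
    also have "\<dots> = cip n (q k) (mapp n h (q j))"
      unfolding cip_def mapp_def h_def
      by (simp add: sum_distrib_left sum_distrib_right ac_simps)
    finally show ?thesis .
  qed
  moreover have "cip n (q k) (mapp n h (q j)) = l j * cip n (q k) (q j)" if "j < n" for j k
    using eigensystemD(1)[OF es that] by (simp add: cip_scale_right[symmetric] cong: cip_cong)
  ultimately have w_orth: "cip m (w j) (w k) = 0" if "j < n" "k < n" "j \<noteq> k" for j k
    using eigensystemD(2)[OF es, of k j] that by simp
  have "cip n (q j) (q k) = (if j = k then 1 else 0)" if "j \<in> K" "k \<in> K" for j k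
  proof (cases "j = k")
    case True
    have "\<not> (\<forall>x<n. q k x = 0)"
    proof
      assume "\<forall>x<n. q k x = 0"
      then have "s k = 0" unfolding s_def w_def by simp
      then show False using that unfolding K_def by simp
    qed
    then show ?thesis using eigensystemD(3)[OF es, of k] that True unfolding K_def by auto
  next
    case False
    then show ?thesis using eigensystemD(2)[OF es, of j k] that unfolding K_def by simp
  qed
  moreover have "cip m (v j) (v k) = (if j = k then 1 else 0)" if "j \<in> K" "k \<in> K" for j k
  proof (cases "j = k")
    case True
    then show ?thesis using that unfolding v_def cip_scale_left cip_scale_right K_def
      by (simp add: ww power2_eq_square)
  next
    case False
    then show ?thesis using that w_orth[of j k] unfolding v_def cip_scale_left cip_scale_right K_def
      by simp
  qed
  moreover have "\<phi> x y = (\<Sum>k\<in>K. of_real (s k) * q k x * v k y)" if x: "x < n" and y: "y < m" for x y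
  proof -
    have "\<phi> x y = (\<Sum>x'<n. (if x = x' then 1 else 0) * \<phi> x' y)"
      using x by (simp add: if_distrib[of "\<lambda>a. a * _"] cong: if_cong)
    also have "\<dots> = (\<Sum>x'<n. \<Sum>k<n. q k x * (cnj (q k x') * \<phi> x' y))"
      using x by (intro sum.cong refl) (simp add: sum_distrib_right mult.assoc flip: complete)
    also have "\<dots> = (\<Sum>k<n. \<Sum>x'<n. q k x * (cnj (q k x') * \<phi> x' y))" by (rule sum.swap)
    also have "\<dots> = (\<Sum>k<n. q k x * w k y)" unfolding w_def by (simp add: sum_distrib_left)
    also have "\<dots> = (\<Sum>k\<in>K. q k x * w k y)"
      using w0 y by (intro sum.mono_neutral_right) (auto simp: K_def)
    also have "\<dots> = (\<Sum>k\<in>K. of_real (s k) * q k x * v k y)"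
      by (intro sum.cong refl) (simp add: v_def K_def)
    finally show ?thesis .
  qed
  moreover have "K \<subseteq> {..<n}" by (auto simp: K_def)
  moreover have "0 < s k" if "k \<in> K" for k
    using that s_nonneg[of k] by (simp add: K_def)
  ultimately show thesis using that by blast
qed

section \<open>Trace norm of the partial transpose\<close>

text \<open>The operator sum of \<open>a p |e p><f p|\<close>, a singular value form once
  \<open>e\<close> and \<open>f\<close> are orthonormal and \<open>a\<close> is nonnegative. The
  index type is free because both single Schmidt indices and pairs of them occur.\<close>

definition outer :: "nat \<Rightarrow> 'p set \<Rightarrow> ('p \<Rightarrow> real) \<Rightarrow> ('p \<Rightarrow> nat \<Rightarrow> complex) \<Rightarrow> ('p \<Rightarrow> nat \<Rightarrow> complex) \<Rightarrow> complex mat" where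
  "outer n P a e f = mat n n (\<lambda>(i, j). \<Sum>p\<in>P. of_real (a p) * e p i * cnj (f p j))"

lemma outer_carrier[simp]: "outer n P a e f \<in> carrier_mat n n"
  by (simp add: outer_def)

lemma adj_outer: "adj (outer n P a e f) = outer n P a f e"
  by (intro eq_matI) (auto simp: adj_def outer_def intro!: sum.cong)

text \<open>Orthonormality of the middle family \<open>f\<close> leaves only the terms with equal
  indices, so the coefficients multiply pointwise.\<close>

lemma outer_mult:
  assumes "finite P"
    and "\<And>p p'. p \<in> P \<Longrightarrow> p' \<in> P \<Longrightarrow> cip n (f p) (f p') = (if p = p' then 1 else 0)"
  shows "outer n P a e f * outer n P b f g = outer n P (\<lambda>p. a p * b p) e g"
proof (intro eq_matI)
  fix i j assume "i < dim_row (outer n P (\<lambda>p. a p * b p) e g)" "j < dim_col (outer n P (\<lambda>p. a p * b p) e g)"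
  then have ij: "i < n" "j < n" by (simp_all add: outer_def)
  then have "(outer n P a e f * outer n P b f g) $$ (i, j) =
    (\<Sum>x<n. \<Sum>p\<in>P. \<Sum>p'\<in>P. (of_real (a p) * e p i * cnj (f p x)) * (of_real (b p') * f p' x * cnj (g p' j)))"
    by (simp add: outer_def scalar_prod_def lessThan_atLeast0 sum_product)
  also have "\<dots> = (\<Sum>p\<in>P. \<Sum>x<n. \<Sum>p'\<in>P. (of_real (a p) * e p i * cnj (f p x)) * (of_real (b p') * f p' x * cnj (g p' j)))"
    by (rule sum.swap)
  also have "\<dots> = (\<Sum>p\<in>P. \<Sum>p'\<in>P. \<Sum>x<n. (of_real (a p) * e p i * cnj (f p x)) * (of_real (b p') * f p' x * cnj (g p' j)))"
    by (intro sum.cong refl sum.swap)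
  also have "\<dots> = (\<Sum>p\<in>P. \<Sum>p'\<in>P. of_real (a p * b p') * e p i * cnj (g p' j) * cip n (f p) (f p'))"
    unfolding cip_def by (simp add: sum_distrib_left ac_simps)
  also have "\<dots> = (\<Sum>p\<in>P. \<Sum>p'\<in>P. if p = p' then of_real (a p * b p) * e p i * cnj (g p j) else 0)"
    using assms(2) by (intro sum.cong refl) auto
  also have "\<dots> = outer n P (\<lambda>p. a p * b p) e g $$ (i, j)"
    using ij assms(1) by (simp add: outer_def)
  finally show "(outer n P a e f * outer n P b f g) $$ (i, j) = outer n P (\<lambda>p. a p * b p) e g $$ (i, j)" .
qed (simp_all add: outer_def)

lemma mtrace_outer:
  assumes "\<And>p. p \<in> P \<Longrightarrow> cip n (e p) (e p) = 1"
  shows "mtrace (outer n P a e e) = of_real (\<Sum>p\<in>P. a p)"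
proof -
  have "mtrace (outer n P a e e) = (\<Sum>i<n. \<Sum>p\<in>P. of_real (a p) * (cnj (e p i) * e p i))"
    by (simp add: mtrace_def outer_def ac_simps)
  also have "\<dots> = (\<Sum>p\<in>P. \<Sum>i<n. of_real (a p) * (cnj (e p i) * e p i))" by (rule sum.swap)
  also have "\<dots> = (\<Sum>p\<in>P. of_real (a p) * cip n (e p) (e p))"
    by (simp add: cip_def sum_distrib_left)
  also have "\<dots> = of_real (\<Sum>p\<in>P. a p)" using assms by simp
  finally show ?thesis .
qed

text \<open>The quadratic form at \<open>v\<close> is the sum of
  \<open>a p * |<e p, v>|^2\<close>.\<close>

lemma psd_outer:
  assumes "\<And>p. p \<in> P \<Longrightarrow> 0 \<le> a p"
  shows "psd n (outer n P a e e)"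
  unfolding psd_iff
proof (intro conjI allI impI)
  fix i j assume "i < n" "j < n"
  then show "outer n P a e e $$ (i, j) = cnj (outer n P a e e $$ (j, i))"
    by (simp add: outer_def ac_simps)
next
  fix v
  have "mapp n (\<lambda>i j. outer n P a e e $$ (i, j)) v i = (\<Sum>p\<in>P. of_real (a p) * cip n (e p) v * e p i)" if "i < n" for i
  proof -
    have "mapp n (\<lambda>i j. outer n P a e e $$ (i, j)) v i = (\<Sum>j<n. \<Sum>p\<in>P. of_real (a p) * (cnj (e p j) * v j) * e p i)"
      using that by (simp add: mapp_def outer_def sum_distrib_left sum_distrib_right ac_simps)
    also have "\<dots> = (\<Sum>p\<in>P. \<Sum>j<n. of_real (a p) * (cnj (e p j) * v j) * e p i)" by (rule sum.swap)
    also have "\<dots> = (\<Sum>p\<in>P. of_real (a p) * cip n (e p) v * e p i)"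
      by (simp add: cip_def sum_distrib_left sum_distrib_right)
    finally show ?thesis .
  qed
  then have "cip n v (mapp n (\<lambda>i j. outer n P a e e $$ (i, j)) v) =
    cip n v (\<lambda>i. \<Sum>p\<in>P. of_real (a p) * cip n (e p) v * e p i)"
    by (intro cip_cong) auto
  also have "\<dots> = (\<Sum>p\<in>P. of_real (a p) * (cip n (e p) v * cnj (cip n (e p) v)))"
    unfolding cip_sum_right cip_scale_right cip_cnj by (simp add: mult.assoc)
  also have "\<dots> = of_real (\<Sum>p\<in>P. a p * (cmod (cip n (e p) v))\<^sup>2)"
    by (simp add: complex_norm_square[symmetric] del: of_real_power)
  finally show "0 \<le> Re (cip n v (mapp n (\<lambda>i j. outer n P a e e $$ (i, j)) v))"
    using assms by (simp add: sum_nonneg)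
qed simp

text \<open>With Schmidt data \<open>s, q, v\<close>, the vectors \<open>e\<^sub>k\<^sub>l = cnj q\<^sub>k \<otimes> v\<^sub>l\<close> are orthonormal and the partial
  transpose is \<open>\<Sum> s\<^sub>k s\<^sub>l |e\<^sub>l\<^sub>k\<rangle>\<langle>e\<^sub>k\<^sub>l|\<close>, whose modulus is \<open>\<Sum> s\<^sub>k s\<^sub>l |e\<^sub>k\<^sub>l\<rangle>\<langle>e\<^sub>k\<^sub>l|\<close>.\<close>
lemma trace_norm_partial_transpose:
  fixes s :: "nat \<Rightarrow> real"
  assumes bij: "bij_betw (\<lambda>i. (fx i, fy i)) {..<N} ({..<n} \<times> {..<m})"
    and K: "finite K" and s: "\<And>k. k \<in> K \<Longrightarrow> 0 < s k"
    and q: "\<And>j k. j \<in> K \<Longrightarrow> k \<in> K \<Longrightarrow> cip n (q j) (q k) = (if j = k then 1 else 0)"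
    and v: "\<And>j k. j \<in> K \<Longrightarrow> k \<in> K \<Longrightarrow> cip m (v j) (v k) = (if j = k then 1 else 0)"
    and \<phi>: "\<And>x y. x < n \<Longrightarrow> y < m \<Longrightarrow> \<phi> x y = (\<Sum>k\<in>K. of_real (s k) * q k x * v k y)"
  shows "trace_norm (mat N N (\<lambda>(i, j). \<phi> (fx j) (fy i) * cnj (\<phi> (fx i) (fy j)))) = (\<Sum>k\<in>K. s k)\<^sup>2"
    (is "trace_norm ?\<sigma> = _")
proof -
  have fx: "fx i < n" and fy: "fy i < m" if "i < N" for i
    using bij_betwE[OF bij] that by auto
  define e where "e = (\<lambda>(k, l) i. cnj (q k (fx i)) * v l (fy i))"
  define a where "a = (\<lambda>(k, l). s k * s l)"
  have orth: "cip N (e p) (e p') = (if p = p' then 1 else 0)" if "p \<in> K \<times> K" "p' \<in> K \<times> K" for p p'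
  proof -
    obtain k l k' l' where p: "p = (k, l)" "p' = (k', l')" by (cases p, cases p')
    have "cip N (e p) (e p') = (\<Sum>i<N. (\<lambda>(x, y). (cnj (q k' x) * q k x) * (cnj (v l y) * v l' y)) (fx i, fy i))"
      unfolding cip_def p e_def by (simp add: ac_simps)
    also have "\<dots> = (\<Sum>(x, y)\<in>{..<n} \<times> {..<m}. (cnj (q k' x) * q k x) * (cnj (v l y) * v l' y))"
      by (rule sum.reindex_bij_betw[OF bij])
    also have "\<dots> = cip n (q k') (q k) * cip m (v l) (v l')"
      unfolding cip_def by (simp add: sum_product sum.cartesian_product)
    also have "\<dots> = (if p = p' then 1 else 0)"
      using that q v by (auto simp: p)
    finally show ?thesis .
  qed
  \<comment> \<open>Exchanging \<open>k\<close> and \<open>l\<close> permutes the index pairs, so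
    \<open>e'\<close> is orthonormal as well.\<close>
  define e' where "e' p = e (prod.swap p)" for p
  have orth': "cip N (e' p) (e' p') = (if p = p' then 1 else 0)" if "p \<in> K \<times> K" "p' \<in> K \<times> K" for p p'
    unfolding e'_def using orth[of "prod.swap p" "prod.swap p'"] that by (auto split: if_splits)
  have fin: "finite (K \<times> K)" using K by simp
  have \<sigma>: "?\<sigma> = outer N (K \<times> K) a e' e"
  proof (intro eq_matI)
    fix i j assume "i < dim_row (outer N (K \<times> K) a e' e)" "j < dim_col (outer N (K \<times> K) a e' e)"
    then have ij: "i < N" "j < N" by (simp_all add: outer_def)
    then have "?\<sigma> $$ (i, j) = (\<Sum>k\<in>K. \<Sum>l\<in>K. (of_real (s k) * q k (fx j) * v k (fy i)) *
        cnj (of_real (s l) * q l (fx i) * v l (fy j)))"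
      using fx fy by (simp add: \<phi> sum_product)
    also have "\<dots> = outer N (K \<times> K) a e' e $$ (i, j)"
      using ij by (simp add: outer_def a_def e'_def e_def sum.cartesian_product ac_simps case_prod_unfold)
    finally show "?\<sigma> $$ (i, j) = outer N (K \<times> K) a e' e $$ (i, j)" .
  qed (simp_all add: outer_def)
  let ?S = "outer N (K \<times> K) a e e"
  \<comment> \<open>By orthonormality of \<open>e\<close> on the left and of \<open>e'\<close> on
    the right, both sides are the \<open>outer\<close> of \<open>e\<close> with itself and squared
    coefficients.\<close>
  have "?S * ?S = adj ?\<sigma> * ?\<sigma>"
    unfolding \<sigma> adj_outer
    using outer_mult[of "K \<times> K" N e a e a e, OF fin orth] outer_mult[of "K \<times> K" N e' a e a e, OF fin orth'] by simp
  moreover have "psd N ?S" using s by (intro psd_outer) (auto simp: a_def less_imp_le)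
  ultimately have "trace_norm ?\<sigma> = Re (mtrace ?S)" by (intro trace_norm_eqI) auto
  also have "\<dots> = (\<Sum>p\<in>K \<times> K. a p)" using orth by (subst mtrace_outer) auto
  also have "\<dots> = (\<Sum>k\<in>K. s k)\<^sup>2"
    by (simp add: a_def power2_eq_square sum_product sum.cartesian_product)
  finally show ?thesis .
qed

text \<open>\<open>?H\<close> is the reduced state on the first factor, already diagonal in the
  \<open>q k\<close> with eigenvalues \<open>(s k)^2\<close>, so its trace and the trace of its
  square can be read off. The fourfold sum is the latter trace, written with two copies whose first
  indices are exchanged; this is the form that \<open>swap_purity\<close> takes.\<close>

lemma schmidt_moments:
  fixes s :: "nat \<Rightarrow> real"
  assumes K: "finite K"
    and q: "\<And>j k. j \<in> K \<Longrightarrow> k \<in> K \<Longrightarrow> cip n (q j) (q k) = (if j = k then 1 else 0)"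
    and v: "\<And>j k. j \<in> K \<Longrightarrow> k \<in> K \<Longrightarrow> cip m (v j) (v k) = (if j = k then 1 else 0)"
    and \<phi>: "\<And>x y. x < n \<Longrightarrow> y < m \<Longrightarrow> \<phi> x y = (\<Sum>k\<in>K. of_real (s k) * q k x * v k y)"
  shows "(\<Sum>x<n. \<Sum>y<m. \<phi> x y * cnj (\<phi> x y)) = of_real (\<Sum>k\<in>K. (s k)\<^sup>2)"
    and "(\<Sum>x<n. \<Sum>y<m. \<Sum>x'<n. \<Sum>y'<m. \<phi> x y * \<phi> x' y' * cnj (\<phi> x' y * \<phi> x y')) = of_real (\<Sum>k\<in>K. (s k) ^ 4)"
proof -
  let ?H = "outer n K (\<lambda>k. (s k)\<^sup>2) q q"
  have H: "?H $$ (x, x') = (\<Sum>y<m. \<phi> x y * cnj (\<phi> x' y))" if "x < n" "x' < n" for x x'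
  proof -
    have "(\<Sum>y<m. \<phi> x y * cnj (\<phi> x' y)) =
      (\<Sum>y<m. \<Sum>k\<in>K. \<Sum>l\<in>K. (of_real (s k) * q k x * v k y) * cnj (of_real (s l) * q l x' * v l y))"
      using that by (simp add: \<phi> sum_product)
    also have "\<dots> = (\<Sum>k\<in>K. \<Sum>y<m. \<Sum>l\<in>K. (of_real (s k) * q k x * v k y) * cnj (of_real (s l) * q l x' * v l y))"
      by (rule sum.swap)
    also have "\<dots> = (\<Sum>k\<in>K. \<Sum>l\<in>K. \<Sum>y<m. (of_real (s k) * q k x * v k y) * cnj (of_real (s l) * q l x' * v l y))"
      by (intro sum.cong refl sum.swap)
    also have "\<dots> = (\<Sum>k\<in>K. \<Sum>l\<in>K. of_real (s k * s l) * q k x * cnj (q l x') * cip m (v l) (v k))"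
      unfolding cip_def by (simp add: sum_distrib_left ac_simps)
    also have "\<dots> = (\<Sum>k\<in>K. \<Sum>l\<in>K. if k = l then of_real ((s k)\<^sup>2) * q k x * cnj (q k x') else 0)"
      using v by (intro sum.cong refl) (auto simp: power2_eq_square)
    also have "\<dots> = ?H $$ (x, x')" using that K by (simp add: outer_def)
    finally show ?thesis by simp
  qed
  have "mtrace ?H = (\<Sum>x<n. \<Sum>y<m. \<phi> x y * cnj (\<phi> x y))"
    using H by (simp add: mtrace_def outer_def)
  then show "(\<Sum>x<n. \<Sum>y<m. \<phi> x y * cnj (\<phi> x y)) = of_real (\<Sum>k\<in>K. (s k)\<^sup>2)"
    using q by (subst (asm) mtrace_outer) auto
  have "(\<Sum>x<n. \<Sum>y<m. \<Sum>x'<n. \<Sum>y'<m. \<phi> x y * \<phi> x' y' * cnj (\<phi> x' y * \<phi> x y')) =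
    (\<Sum>x<n. \<Sum>x'<n. \<Sum>y<m. \<Sum>y'<m. \<phi> x y * \<phi> x' y' * cnj (\<phi> x' y * \<phi> x y'))"
    by (intro sum.cong refl sum.swap)
  also have "\<dots> = (\<Sum>x<n. \<Sum>x'<n. (\<Sum>y<m. \<phi> x y * cnj (\<phi> x' y)) * (\<Sum>y'<m. \<phi> x' y' * cnj (\<phi> x y')))"
    unfolding sum_product by (simp add: ac_simps)
  also have "\<dots> = (\<Sum>x<n. \<Sum>x'<n. ?H $$ (x, x') * ?H $$ (x', x))"
    by (intro sum.cong refl) (simp add: H)
  also have "\<dots> = mtrace (?H * ?H)"
    by (simp add: mtrace_def outer_def scalar_prod_def lessThan_atLeast0)
  also have "\<dots> = mtrace (outer n K (\<lambda>k. (s k)\<^sup>2 * (s k)\<^sup>2) q q)"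
    using K q by (subst outer_mult) auto
  also have "\<dots> = of_real (\<Sum>k\<in>K. (s k) ^ 4)"
    using q by (subst mtrace_outer) (auto simp flip: power_add)
  finally show "(\<Sum>x<n. \<Sum>y<m. \<Sum>x'<n. \<Sum>y'<m. \<phi> x y * \<phi> x' y' * cnj (\<phi> x' y * \<phi> x y')) = of_real (\<Sum>k\<in>K. (s k) ^ 4)" .
qed

section \<open>Power sums of Schmidt coefficients\<close>

lemma power4_sum_le_square_sum_square:
  fixes s :: "'k \<Rightarrow> real"
  assumes "finite K"
  shows "(\<Sum>k\<in>K. (s k) ^ 4) \<le> (\<Sum>k\<in>K. (s k)\<^sup>2)\<^sup>2"
  using assms
proof induction
  case (insert a K)
  have "0 \<le> (s a)\<^sup>2 * (\<Sum>k\<in>K. (s k)\<^sup>2)" by (simp add: sum_nonneg)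
  then show ?case using insert by (simp add: power2_sum)
qed simp

text \<open>With \<open>A\<close>, \<open>B\<close>, \<open>C\<close> the power sums of orders 1, 2,
  4, and sums over unordered pairs, \<open>A^2 - B\<close> is twice the sum of
  \<open>s k * s l\<close>, and \<open>2 * (B^2 - C)\<close> is four times the sum of the squares of
  these products. The square of a sum of nonnegative numbers dominates the sum of their squares. The
  first conjunct supplies the sign of the new cross term in the induction.\<close>

lemma cross_terms_lower_bound:
  fixes s :: "'k \<Rightarrow> real"
  assumes "finite K" and "\<And>k. k \<in> K \<Longrightarrow> 0 \<le> s k"
  shows "(\<Sum>k\<in>K. (s k)\<^sup>2) \<le> (\<Sum>k\<in>K. s k)\<^sup>2 \<and>
    2 * ((\<Sum>k\<in>K. (s k)\<^sup>2)\<^sup>2 - (\<Sum>k\<in>K. (s k) ^ 4)) \<le> ((\<Sum>k\<in>K. s k)\<^sup>2 - (\<Sum>k\<in>K. (s k)\<^sup>2))\<^sup>2"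
  using assms
proof induction
  case (insert a K)
  define A B C where "A = (\<Sum>k\<in>K. s k)" and "B = (\<Sum>k\<in>K. (s k)\<^sup>2)" and "C = (\<Sum>k\<in>K. (s k) ^ 4)"
  have IH: "B \<le> A\<^sup>2" "2 * (B\<^sup>2 - C) \<le> (A\<^sup>2 - B)\<^sup>2"
    using insert.IH insert.prems by (simp_all add: A_def B_def C_def)
  have A: "0 \<le> A" unfolding A_def using insert.prems by (simp add: sum_nonneg)
  have a: "0 \<le> s a" using insert.prems by simp
  have "(s a)\<^sup>2 + B \<le> (s a + A)\<^sup>2"
    using IH(1) mult_nonneg_nonneg[OF a A] by (simp add: power2_sum)
  moreover have "2 * (((s a)\<^sup>2 + B)\<^sup>2 - ((s a) ^ 4 + C)) \<le> ((s a + A)\<^sup>2 - ((s a)\<^sup>2 + B))\<^sup>2"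
  proof -
    have "2 * (((s a)\<^sup>2 + B)\<^sup>2 - ((s a) ^ 4 + C)) = 2 * (B\<^sup>2 - C) + 4 * (s a)\<^sup>2 * B"
      by (simp add: power2_eq_square power4_eq_xxxx algebra_simps)
    also have "\<dots> \<le> (A\<^sup>2 - B)\<^sup>2 + 4 * (s a)\<^sup>2 * A\<^sup>2"
      using IH by (intro add_mono mult_left_mono) auto
    \<comment> \<open>Adds the cross term of the square of
      \<open>(A^2 - B) + 2 * s a * A\<close>.\<close>
    also have "\<dots> \<le> (A\<^sup>2 - B)\<^sup>2 + 4 * (s a)\<^sup>2 * A\<^sup>2 + 4 * (s a * A) * (A\<^sup>2 - B)"
      using IH(1) a A by simp
    also have "\<dots> = ((s a + A)\<^sup>2 - ((s a)\<^sup>2 + B))\<^sup>2"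
      by (simp add: power2_eq_square algebra_simps)
    finally show ?thesis .
  qed
  ultimately show ?case using insert.hyps by (simp add: A_def B_def C_def)
qed simp

text \<open>At most two coefficients form at most one pair, so the sum of pair products has at most
  one term and squaring it loses nothing. This is where the dimension of the qubit enters.\<close>

lemma cross_terms_two:
  fixes s :: "'k \<Rightarrow> real"
  assumes "finite K" and "card K \<le> 2"
  shows "((\<Sum>k\<in>K. s k)\<^sup>2 - (\<Sum>k\<in>K. (s k)\<^sup>2))\<^sup>2 = 2 * ((\<Sum>k\<in>K. (s k)\<^sup>2)\<^sup>2 - (\<Sum>k\<in>K. (s k) ^ 4))"
proof -
  consider "K = {}" | a where "K = {a}" | a b where "K = {a, b}" "a \<noteq> b"
    using assms by (metis card_0_eq card_1_singletonE card_2_iff le_SucE le_zero_eq numeral_2_eq_2 One_nat_def)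
  then show ?thesis
    by cases (simp_all add: power2_eq_square power4_eq_xxxx algebra_simps)
qed

section \<open>Purities of a tripartite state\<close>

text \<open>The map from \<open>(i, j)\<close> to \<open>(mix dB dC X i j, mix dB dC X j i)\<close>
  exchanges the \<open>X\<close> parts of two basis indices. It describes both the partial transpose
  of a matrix and the flips acting on two copies of the state.\<close>

definition mix :: "nat \<Rightarrow> nat \<Rightarrow> nat set \<Rightarrow> nat \<Rightarrow> nat \<Rightarrow> nat" where
  "mix dB dC X i j = enc dB dC (\<lambda>k. if k \<in> X then comp dB dC k j else comp dB dC k i)"

text \<open>\<open>Tr \<rho>\<^sub>X\<^sup>2\<close>, written as the overlap of \<open>\<psi> \<otimes> \<psi>\<close> with its image under exchanging the \<open>X\<close> parts.\<close>
definition swap_purity :: "nat \<Rightarrow> nat \<Rightarrow> nat set \<Rightarrow> complex vec \<Rightarrow> real" where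
  "swap_purity dB dC X \<psi> = Re (\<Sum>i<dim_vec \<psi>. \<Sum>j<dim_vec \<psi>.
     \<psi> $ i * \<psi> $ j * cnj (\<psi> $ mix dB dC X i j * \<psi> $ mix dB dC X j i))"

section \<open>Mixed-radix arithmetic of the product basis indices\<close>

lemma mult_add_div_mod:
  fixes a d r :: nat
  assumes "r < d"
  shows "(a * d + r) div d = a" "(a * d + r) mod d = r"
  using assms by auto

lemma mult_add_less:
  fixes x a d r :: nat
  assumes "x < a" "r < d"
  shows "x * d + r < a * d"
proof -
  have "x * d + r < (x + 1) * d" using assms by simp
  also have "\<dots> \<le> a * d" using assms by (intro mult_right_mono) auto
  finally show ?thesis .
qed

lemma enc_less:
  assumes "f 0 < 2" "f 1 < dB" "f 2 < dC"
  shows "enc dB dC f < 2 * dB * dC"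
  using mult_add_less[OF assms(1) mult_add_less[OF assms(2,3)]]
  by (simp add: enc_def mult.assoc add.assoc)

lemma comp_enc:
  assumes "f 1 < dB" "f 2 < dC"
  shows "comp dB dC 0 (enc dB dC f) = f 0" "comp dB dC (Suc 0) (enc dB dC f) = f 1" "comp dB dC 2 (enc dB dC f) = f 2"
proof -
  have e: "enc dB dC f = f 0 * (dB * dC) + (f 1 * dC + f 2)" by (simp add: enc_def)
  have e': "enc dB dC f = (f 0 * dB + f 1) * dC + f 2" by (simp add: enc_def algebra_simps)
  show "comp dB dC 0 (enc dB dC f) = f 0"
    unfolding comp_def e using mult_add_div_mod(1)[OF mult_add_less[OF assms]] by simp
  show "comp dB dC (Suc 0) (enc dB dC f) = f 1"
    unfolding comp_def e' mult_add_div_mod(1)[OF assms(2)] using mult_add_div_mod(2)[OF assms(1)] by simp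
  show "comp dB dC 2 (enc dB dC f) = f 2"
    unfolding comp_def e' using mult_add_div_mod(2)[OF assms(2)] by simp
qed

text \<open>The leading digit \<open>comp dB dC 0 i\<close> is an unreduced quotient, so the
  expansion is exact for every \<open>i\<close>.\<close>

lemma enc_comp: "enc dB dC (\<lambda>k. comp dB dC k i) = i"
proof -
  have "i div dC = (i div (dB * dC)) * dB + (i div dC) mod dB"
    by (metis div_mult2_eq div_mult_mod_eq mult.commute)
  then have "i = ((i div (dB * dC)) * dB + (i div dC) mod dB) * dC + i mod dC"
    by (metis div_mult_mod_eq)
  then show ?thesis by (simp add: enc_def comp_def algebra_simps)
qed

lemma comp_less:
  assumes "i < 2 * dB * dC" "dB > 0" "dC > 0"
  shows "comp dB dC 0 i < 2" "comp dB dC (Suc 0) i < dB" "comp dB dC 2 i < dC"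
  using assms by (auto simp: comp_def div_less_iff_less_mult mult.assoc)

lemma enc_cong: "f 0 = g 0 \<Longrightarrow> f 1 = g 1 \<Longrightarrow> f 2 = g 2 \<Longrightarrow> enc dB dC f = enc dB dC g"
  by (simp add: enc_def)

lemma
  assumes "i < 2 * dB * dC" "j < 2 * dB * dC" "dB > 0" "dC > 0"
  shows mix_less: "mix dB dC X i j < 2 * dB * dC"
    and comp_mix: "k \<in> {0, 1, 2} \<Longrightarrow> comp dB dC k (mix dB dC X i j) = (if k \<in> X then comp dB dC k j else comp dB dC k i)"
  using comp_less[OF assms(1,3,4)] comp_less[OF assms(2,3,4)]
  by (auto simp: mix_def enc_less comp_enc)

lemma mix_self: "mix dB dC X i i = i"
  by (simp add: mix_def enc_comp)

text \<open>A party exchanged twice returns to its place, so only the symmetric difference remains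
  exchanged.\<close>

lemma mix_mix:
  assumes "i < 2 * dB * dC" "j < 2 * dB * dC" "dB > 0" "dC > 0"
  shows "mix dB dC X (mix dB dC Y i j) (mix dB dC Y j i) = mix dB dC ((X - Y) \<union> (Y - X)) i j"
  unfolding mix_def[of _ _ X] mix_def[of _ _ "_ \<union> _"]
  using assms by (intro enc_cong) (simp_all add: comp_mix)

text \<open>Exchanging all parties outside \<open>X\<close> is the same as exchanging
  \<open>X\<close> and then swapping the two whole copies.\<close>

lemma mix_compl: "mix dB dC (- X) i j = mix dB dC X j i"
  unfolding mix_def by (intro enc_cong) auto

lemma mix_cong: "X \<inter> {0, 1, 2} = Y \<inter> {0, 1, 2} \<Longrightarrow> mix dB dC X i j = mix dB dC Y i j"
  unfolding mix_def by (intro enc_cong) auto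

section \<open>Trace norms and purities across a bipartition\<close>

lemma ptrans_proj:
  assumes "\<psi> \<in> carrier_vec (2 * dB * dC)" "dB > 0" "dC > 0"
  shows "ptrans dB dC X (proj \<psi>) = mat (2 * dB * dC) (2 * dB * dC)
    (\<lambda>(i, j). \<psi> $ mix dB dC X i j * cnj (\<psi> $ mix dB dC X j i))"
proof (rule eq_matI)
  fix i j assume "i < dim_row (mat (2 * dB * dC) (2 * dB * dC) (\<lambda>(i, j). \<psi> $ mix dB dC X i j * cnj (\<psi> $ mix dB dC X j i)))"
    "j < dim_col (mat (2 * dB * dC) (2 * dB * dC) (\<lambda>(i, j). \<psi> $ mix dB dC X i j * cnj (\<psi> $ mix dB dC X j i)))"
  then have ij: "i < 2 * dB * dC" "j < 2 * dB * dC" by simp_all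
  then show "ptrans dB dC X (proj \<psi>) $$ (i, j) = mat (2 * dB * dC) (2 * dB * dC)
    (\<lambda>(i, j). \<psi> $ mix dB dC X i j * cnj (\<psi> $ mix dB dC X j i)) $$ (i, j)"
    using assms mix_less[OF ij assms(2,3), of X] mix_less[OF ij(2,1) assms(2,3), of X]
    by (simp add: ptrans_def proj_def mix_def)
qed (use assms in \<open>simp_all add: ptrans_def proj_def\<close>)

text \<open>The bijection splits a basis index into its \<open>X\<close> part \<open>fx\<close> and
  the rest \<open>fy\<close>, and \<open>\<phi>\<close> is the coefficient matrix of the state for
  this split. Its Schmidt coefficients have square sum 1, fourth power sum equal to the purity, and
  the trace norm as the square of their sum; the power sum lemmas then give all three
  claims.\<close>

lemma trace_norm_ptrans_bounds:
  fixes n m :: nat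
  assumes bij: "bij_betw (\<lambda>i. (fx i, fy i)) {..<2 * dB * dC} ({..<n} \<times> {..<m})"
    and dims: "dB > 0" "dC > 0" and \<psi>: "\<psi> \<in> carrier_vec (2 * dB * dC)"
    and norm: "(\<Sum>i<dim_vec \<psi>. (cmod (\<psi> $ i))\<^sup>2) = 1"
    and \<phi>: "\<And>i j. i < 2 * dB * dC \<Longrightarrow> j < 2 * dB * dC \<Longrightarrow> \<phi> (fx j) (fy i) = \<psi> $ mix dB dC X i j"
  shows "swap_purity dB dC X \<psi> \<le> 1"
    and "1 + sqrt (2 * (1 - swap_purity dB dC X \<psi>)) \<le> trace_norm (ptrans dB dC X (proj \<psi>))"
    and "n \<le> 2 \<Longrightarrow> trace_norm (ptrans dB dC X (proj \<psi>)) = 1 + sqrt (2 * (1 - swap_purity dB dC X \<psi>))"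
proof -
  let ?N = "2 * dB * dC" and ?T = "trace_norm (ptrans dB dC X (proj \<psi>))"
  obtain K :: "nat set" and s :: "nat \<Rightarrow> real" and q v where
      K: "K \<subseteq> {..<n}" and s: "\<And>k. k \<in> K \<Longrightarrow> 0 < s k"
    and q: "\<And>j k. j \<in> K \<Longrightarrow> k \<in> K \<Longrightarrow> cip n (q j) (q k) = (if j = k then 1 else 0)"
    and v: "\<And>j k. j \<in> K \<Longrightarrow> k \<in> K \<Longrightarrow> cip m (v j) (v k) = (if j = k then 1 else 0)"
    and sd: "\<And>x y. x < n \<Longrightarrow> y < m \<Longrightarrow> \<phi> x y = (\<Sum>k\<in>K. of_real (s k) * q k x * v k y)"
    by (rule schmidt_decomposition[of n m \<phi>]) blast
  have fin: "finite K" using K finite_subset by blast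
  \<comment> \<open>The case \<open>j = i\<close> of the assumption identifies \<open>\<phi>\<close>
    as a rearrangement of \<open>\<psi>\<close>.\<close>
  have diag: "\<phi> (fx i) (fy i) = \<psi> $ i" if "i < ?N" for i
    using \<phi>[OF that that] by (simp add: mix_self)
  have reindex: "(\<Sum>x<n. \<Sum>y<m. g x y) = (\<Sum>i<?N. g (fx i) (fy i))" for g :: "nat \<Rightarrow> nat \<Rightarrow> complex"
    using sum.reindex_bij_betw[OF bij, of "\<lambda>(x, y). g x y"] by (simp add: sum.cartesian_product)
  have "ptrans dB dC X (proj \<psi>) = mat ?N ?N (\<lambda>(i, j). \<phi> (fx j) (fy i) * cnj (\<phi> (fx i) (fy j)))"
    unfolding ptrans_proj[OF \<psi> dims] by (intro cong_mat) (auto simp: \<phi>)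
  then have T: "?T = (\<Sum>k\<in>K. s k)\<^sup>2"
    using trace_norm_partial_transpose[OF bij fin s q v sd] by simp
  have "complex_of_real (\<Sum>k\<in>K. (s k)\<^sup>2) = (\<Sum>i<?N. \<phi> (fx i) (fy i) * cnj (\<phi> (fx i) (fy i)))"
    using schmidt_moments(1)[OF fin q v sd] by (simp add: reindex)
  also have "\<dots> = of_real (\<Sum>i<?N. (cmod (\<psi> $ i))\<^sup>2)"
    by (simp add: diag complex_norm_square[symmetric] del: of_real_power)
  finally have s2: "(\<Sum>k\<in>K. (s k)\<^sup>2) = 1"
    using norm \<psi> by (simp only: of_real_eq_iff carrier_vecD)
  have "complex_of_real (\<Sum>k\<in>K. (s k) ^ 4) = (\<Sum>i<?N. \<Sum>j<?N.
      \<phi> (fx i) (fy i) * \<phi> (fx j) (fy j) * cnj (\<phi> (fx j) (fy i) * \<phi> (fx i) (fy j)))"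
    using schmidt_moments(2)[OF fin q v sd] by (simp add: reindex)
  also have "\<dots> = (\<Sum>i<?N. \<Sum>j<?N. \<psi> $ i * \<psi> $ j * cnj (\<psi> $ mix dB dC X i j * \<psi> $ mix dB dC X j i))"
    by (intro sum.cong refl) (simp add: diag \<phi>)
  finally have s4: "complex_of_real (\<Sum>k\<in>K. (s k) ^ 4) =
    (\<Sum>i<?N. \<Sum>j<?N. \<psi> $ i * \<psi> $ j * cnj (\<psi> $ mix dB dC X i j * \<psi> $ mix dB dC X j i))" .
  have P: "swap_purity dB dC X \<psi> = (\<Sum>k\<in>K. (s k) ^ 4)"
    unfolding swap_purity_def carrier_vecD[OF \<psi>] s4[symmetric] by (rule Re_complex_of_real)
  show "swap_purity dB dC X \<psi> \<le> 1"
    using power4_sum_le_square_sum_square[OF fin, of s] by (simp add: P s2)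
  have ge: "1 \<le> ?T" "2 * (1 - swap_purity dB dC X \<psi>) \<le> (?T - 1)\<^sup>2"
    using cross_terms_lower_bound[OF fin, of s] s by (simp_all add: P s2 T less_imp_le)
  then have "sqrt (2 * (1 - swap_purity dB dC X \<psi>)) \<le> ?T - 1"
    by (intro real_le_lsqrt) auto
  then show "1 + sqrt (2 * (1 - swap_purity dB dC X \<psi>)) \<le> ?T" by simp
  assume "n \<le> 2"
  then have "card K \<le> 2" using card_mono[OF finite_lessThan K] by simp
  then have "(?T - 1)\<^sup>2 = 2 * (1 - swap_purity dB dC X \<psi>)"
    using cross_terms_two[OF fin, of s] by (simp add: P s2 T)
  then have "sqrt (2 * (1 - swap_purity dB dC X \<psi>)) = ?T - 1"
    using ge(1) by (metis diff_ge_0_iff_ge real_sqrt_unique)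
  then show "?T = 1 + sqrt (2 * (1 - swap_purity dB dC X \<psi>))" by simp
qed

text \<open>This is \<open>\<langle>\<Psi>| (1 - F) (1 - G) |\<Psi>\<rangle> \<ge> 0\<close> for the commuting reflections \<open>F\<close>, \<open>G\<close> induced by \<open>f\<close>, \<open>g\<close>.\<close>
lemma commuting_involutions_positivity:
  fixes \<Psi> :: "'a \<Rightarrow> complex"
  assumes f: "\<And>p. p \<in> \<Omega> \<Longrightarrow> f p \<in> \<Omega> \<and> f (f p) = p"
    and g: "\<And>p. p \<in> \<Omega> \<Longrightarrow> g p \<in> \<Omega> \<and> g (g p) = p"
    and comm: "\<And>p. p \<in> \<Omega> \<Longrightarrow> f (g p) = g (f p)"
  shows "Re (\<Sum>p\<in>\<Omega>. \<Psi> p * cnj (\<Psi> (f p))) + Re (\<Sum>p\<in>\<Omega>. \<Psi> p * cnj (\<Psi> (g p)))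
    \<le> (\<Sum>p\<in>\<Omega>. (cmod (\<Psi> p))\<^sup>2) + Re (\<Sum>p\<in>\<Omega>. \<Psi> p * cnj (\<Psi> (f (g p))))"
proof -
  define R where "R x y = Re (x * cnj y)" for x y
  have R_lin: "R (x - y) z = R x z - R y z" "R z (x - y) = R z x - R z y" "R x x = (cmod x)\<^sup>2" "R x y = R y x" for x y z
    by (simp_all add: R_def algebra_simps cmod_power2 flip: power2_eq_square)
  have bij_f: "bij_betw f \<Omega> \<Omega>" by (rule bij_betw_byWitness[where f' = f]) (use f in auto)
  have bij_g: "bij_betw g \<Omega> \<Omega>" by (rule bij_betw_byWitness[where f' = g]) (use g in auto)
  have sum_f: "(\<Sum>p\<in>\<Omega>. h (f p)) = (\<Sum>p\<in>\<Omega>. h p)" for h :: "'a \<Rightarrow> real"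
    by (rule sum.reindex_bij_betw[OF bij_f])
  have sum_g: "(\<Sum>p\<in>\<Omega>. h (g p)) = (\<Sum>p\<in>\<Omega>. h p)" for h :: "'a \<Rightarrow> real"
    by (rule sum.reindex_bij_betw[OF bij_g])
  define U where "U p = \<Psi> p - \<Psi> (f p)" for p
  let ?I = "\<lambda>u v. \<Sum>p\<in>\<Omega>. R (u p) (v p)"
  have sym: "?I u v = ?I v u" for u v by (intro sum.cong refl R_lin(4))
  have "?I (\<lambda>p. \<Psi> (f p)) (\<lambda>p. \<Psi> (g p)) = (\<Sum>p\<in>\<Omega>. R (\<Psi> p) (\<Psi> (g (f p))))"
    using f by (subst sum_f[symmetric]) simp
  also have "\<dots> = ?I \<Psi> (\<lambda>p. \<Psi> (f (g p)))" using comm by (intro sum.cong) auto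
  finally have fg: "?I (\<lambda>p. \<Psi> (f p)) (\<lambda>p. \<Psi> (g p)) = ?I \<Psi> (\<lambda>p. \<Psi> (f (g p)))" .
  have "?I (\<lambda>p. \<Psi> (f p)) (\<lambda>p. \<Psi> (f (g p))) = (\<Sum>p\<in>\<Omega>. R (\<Psi> (f p)) (\<Psi> (g (f p))))"
    using comm by (intro sum.cong) auto
  also have "\<dots> = ?I \<Psi> (\<lambda>p. \<Psi> (g p))" by (rule sum_f)
  finally have ffg: "?I (\<lambda>p. \<Psi> (f p)) (\<lambda>p. \<Psi> (f (g p))) = ?I \<Psi> (\<lambda>p. \<Psi> (g p))" .
  have "?I (\<lambda>p. \<Psi> (f p)) (\<lambda>p. \<Psi> (f p)) = ?I \<Psi> \<Psi>" by (rule sum_f)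
  then have UU: "?I U U = 2 * ?I \<Psi> \<Psi> - 2 * ?I \<Psi> (\<lambda>p. \<Psi> (f p))"
    unfolding U_def R_lin(1,2) sum_subtractf sym[of "\<lambda>p. \<Psi> (f p)" \<Psi>] by simp
  have UgU: "?I U (\<lambda>p. U (g p)) = 2 * ?I \<Psi> (\<lambda>p. \<Psi> (g p)) - 2 * ?I \<Psi> (\<lambda>p. \<Psi> (f (g p)))"
    unfolding U_def R_lin(1,2) sum_subtractf fg ffg by simp
  \<comment> \<open>The squared norm of \<open>(1 - G) (1 - F) \<Psi>\<close> is four times the
    claimed difference, because \<open>1 - F\<close> and \<open>1 - G\<close> commute and each
    squares to twice itself.\<close>
  have "0 \<le> (\<Sum>p\<in>\<Omega>. (cmod (U p - U (g p)))\<^sup>2)" by (simp add: sum_nonneg)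
  also have "\<dots> = ?I U U + ?I (\<lambda>p. U (g p)) (\<lambda>p. U (g p)) - 2 * ?I U (\<lambda>p. U (g p))"
    unfolding R_lin(3)[symmetric] R_lin(1,2) sum_subtractf sym[of "\<lambda>p. U (g p)" U] by simp
  also have "?I (\<lambda>p. U (g p)) (\<lambda>p. U (g p)) = ?I U U" by (rule sum_g)
  finally have "?I \<Psi> (\<lambda>p. \<Psi> (f p)) + ?I \<Psi> (\<lambda>p. \<Psi> (g p)) \<le> ?I \<Psi> \<Psi> + ?I \<Psi> (\<lambda>p. \<Psi> (f (g p)))"
    unfolding UU UgU by simp
  then show ?thesis unfolding R_lin(3) by (simp add: R_def)
qed

text \<open>Take for the two reflections the exchanges of \<open>AC\<close> and of
  \<open>AB\<close>. Their product exchanges \<open>BC\<close>, which on the symmetric vector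
  \<open>\<psi> \<otimes> \<psi>\<close> acts like exchanging \<open>A\<close>. By purity of the
  state, \<open>AC\<close> and \<open>AB\<close> stand for \<open>B\<close> and \<open>C\<close>, so
  this is subadditivity of the linear entropy.\<close>

lemma swap_purity_subadditive:
  assumes dims: "dB > 0" "dC > 0" and \<psi>: "\<psi> \<in> carrier_vec (2 * dB * dC)"
    and norm: "(\<Sum>i<dim_vec \<psi>. (cmod (\<psi> $ i))\<^sup>2) = 1"
  shows "swap_purity dB dC {0, 2} \<psi> + swap_purity dB dC {0, 1} \<psi> \<le> 1 + swap_purity dB dC {0} \<psi>"
proof -
  let ?N = "2 * dB * dC"
  define \<Omega> where "\<Omega> = {..<?N} \<times> {..<?N}"
  define \<Psi> where "\<Psi> = (\<lambda>(i, j). \<psi> $ i * \<psi> $ j)"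
  define F where "F X = (\<lambda>(i, j). (mix dB dC X i j, mix dB dC X j i))" for X
  have F_in: "F X p \<in> \<Omega>" if "p \<in> \<Omega>" for X p
    using that dims by (auto simp: F_def \<Omega>_def mix_less)
  have FF: "F X (F Y p) = F ((X - Y) \<union> (Y - X)) p" if "p \<in> \<Omega>" for X Y p
    using that dims by (auto simp: F_def \<Omega>_def mix_mix)
  have F_empty: "F {} p = p" for p
    by (auto simp: F_def mix_def enc_comp)
  have purity: "swap_purity dB dC X \<psi> = Re (\<Sum>p\<in>\<Omega>. \<Psi> p * cnj (\<Psi> (F X p)))" for X
    using \<psi> by (simp add: swap_purity_def \<Omega>_def \<Psi>_def F_def sum.cartesian_product case_prod_unfold)
  have "(\<Sum>p\<in>\<Omega>. (cmod (\<Psi> p))\<^sup>2) = (\<Sum>i<?N. (cmod (\<psi> $ i))\<^sup>2) * (\<Sum>j<?N. (cmod (\<psi> $ j))\<^sup>2)"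
    by (simp add: \<Omega>_def \<Psi>_def sum_product sum.cartesian_product case_prod_unfold norm_mult power_mult_distrib)
  then have one: "(\<Sum>p\<in>\<Omega>. (cmod (\<Psi> p))\<^sup>2) = 1" using norm \<psi> by simp
  have "\<Psi> (F {0, 2} (F {0, 1} p)) = \<Psi> (F {0} p)" if "p \<in> \<Omega>" for p
  proof -
    obtain i j where p: "p = (i, j)" by (cases p)
    \<comment> \<open>The symmetric difference is \<open>{1, 2}\<close>, which agrees with the
      complement of \<open>{0}\<close> on the three parties.\<close>
    have "mix dB dC ({0, 2} - {0, 1} \<union> ({0, 1} - {0, 2})) i j = mix dB dC {0} j i" for i j
      unfolding mix_compl[of dB dC "{0}" i j, symmetric] by (rule mix_cong) auto
    then show ?thesis unfolding FF[OF that] by (simp add: p F_def \<Psi>_def)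
  qed
  then have "Re (\<Sum>p\<in>\<Omega>. \<Psi> p * cnj (\<Psi> (F {0, 2} (F {0, 1} p)))) = swap_purity dB dC {0} \<psi>"
    unfolding purity by simp
  moreover have "Re (\<Sum>p\<in>\<Omega>. \<Psi> p * cnj (\<Psi> (F {0, 2} p))) + Re (\<Sum>p\<in>\<Omega>. \<Psi> p * cnj (\<Psi> (F {0, 1} p)))
    \<le> (\<Sum>p\<in>\<Omega>. (cmod (\<Psi> p))\<^sup>2) + Re (\<Sum>p\<in>\<Omega>. \<Psi> p * cnj (\<Psi> (F {0, 2} (F {0, 1} p))))"
    by (rule commuting_involutions_positivity) (simp_all add: F_in FF F_empty Un_commute)
  ultimately show ?thesis unfolding purity[of "{0, 2}"] purity[of "{0, 1}"] one by simp
qed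

section \<open>The inequality for logarithmic negativities\<close>

theorem theorem2:
  fixes dB dC :: nat and \<psi> :: "complex vec"
  assumes "dB > 0" and "dC > 0"
    and "\<psi> \<in> carrier_vec (2 * dB * dC)"
    and "(\<Sum>i<dim_vec \<psi>. (cmod (\<psi> $ i))\<^sup>2) = 1"
  shows "log_neg dB dC {0} (proj \<psi>) - log_neg dB dC {0,2} (proj \<psi>)
           \<le> log_neg dB dC {0,1} (proj \<psi>)"
proof -
  let ?N = "2 * dB * dC" and ?c = "comp dB dC"
  let ?T = "\<lambda>X. trace_norm (ptrans dB dC X (proj \<psi>))" and ?P = "\<lambda>X. swap_purity dB dC X \<psi>"
  note dims = assms(1,2) and cl = comp_less[OF _ assms(1,2)]
  \<comment> \<open>\<open>A\<close> and \<open>C\<close> are not adjacent digits of the encoding,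
    so \<open>x\<close> packs them as \<open>a * dC + c\<close>, and \<open>g\<close> reinserts the
    digit \<open>y\<close> of \<open>B\<close> between them.\<close>
  define g where "g x y = enc dB dC (\<lambda>k. if k = 0 then x div dC else if k = 1 then y else x mod dC)" for x y
  have split: "i div (dB * dC) * dB + i div dC mod dB = i div dC" "i mod (dB * dC) = i div dC mod dB * dC + i mod dC" for i
    by (metis div_mult2_eq div_mult_mod_eq mult.commute, metis mod_mult2_eq mult.commute)
  have mix_0: "mix dB dC {0} i j = ?c 0 j * (dB * dC) + i mod (dB * dC)" for i j
    by (simp add: mix_def enc_def comp_def split(2))
  have mix_01: "mix dB dC {0, 1} i j = j div dC * dC + ?c 2 i" for i j
  proof -
    have "mix dB dC {0, 1} i j = (?c 0 j * dB + ?c 1 j) * dC + ?c 2 i"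
      by (simp add: mix_def enc_def add_mult_distrib)
    moreover have "?c 0 j * dB + ?c 1 j = j div dC" by (simp add: comp_def split(1))
    ultimately show ?thesis by simp
  qed
  have mix_02: "mix dB dC {0, 2} i j = g (?c 0 j * dC + ?c 2 j) (?c 1 i)" if "j < ?N" for i j
    unfolding g_def mix_def mult_add_div_mod[OF cl(3)[OF that]] by (rule enc_cong) simp_all
  have bijA: "bij_betw (\<lambda>i. (?c 0 i, i mod (dB * dC))) {..<?N} ({..<2} \<times> {..<dB * dC})"
    using dims by (intro bij_betw_byWitness[where f' = "\<lambda>(x, y). x * (dB * dC) + y"])
      (auto simp: comp_def div_less_iff_less_mult mult.assoc mult_add_less div_mult_mod_eq)
  have bijC: "bij_betw (\<lambda>i. (i div dC, ?c 2 i)) {..<?N} ({..<2 * dB} \<times> {..<dC})"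
    using dims by (intro bij_betw_byWitness[where f' = "\<lambda>(x, y). x * dC + y"])
      (auto simp: comp_def div_less_iff_less_mult mult_add_less div_mult_mod_eq)
  have bijB: "bij_betw (\<lambda>i. (?c 0 i * dC + ?c 2 i, ?c 1 i)) {..<?N} ({..<2 * dC} \<times> {..<dB})"
  proof (rule bij_betw_byWitness[where f' = "\<lambda>(x, y). g x y"])
    show "\<forall>i\<in>{..<?N}. (case (?c 0 i * dC + ?c 2 i, ?c 1 i) of (x, y) \<Rightarrow> g x y) = i"
    proof
      fix i assume "i \<in> {..<?N}"
      then have "?c 2 i < dC" using cl by simp
      note dm = mult_add_div_mod[OF this]
      have "g (?c 0 i * dC + ?c 2 i) (?c 1 i) = enc dB dC (\<lambda>k. ?c k i)"
        unfolding g_def dm by (rule enc_cong) simp_all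
      then show "(case (?c 0 i * dC + ?c 2 i, ?c 1 i) of (x, y) \<Rightarrow> g x y) = i"
        by (simp add: enc_comp)
    qed
    show "\<forall>p\<in>{..<2 * dC} \<times> {..<dB}. (\<lambda>i. (?c 0 i * dC + ?c 2 i, ?c 1 i)) (case p of (x, y) \<Rightarrow> g x y) = p"
      using dims by (auto simp: g_def comp_enc)
    show "(\<lambda>i. (?c 0 i * dC + ?c 2 i, ?c 1 i)) ` {..<?N} \<subseteq> {..<2 * dC} \<times> {..<dB}"
      using cl by (auto intro!: mult_add_less)
    show "(\<lambda>(x, y). g x y) ` ({..<2 * dC} \<times> {..<dB}) \<subseteq> {..<?N}"
      using dims by (auto simp: g_def div_less_iff_less_mult intro!: enc_less)
  qed
  \<comment> \<open>The first factor has dimension 2, so the trace norm is known exactly. The other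
    two bipartitions contribute lower bounds, the direction required for the right-hand
    side.\<close>
  have A: "?P {0} \<le> 1" "?T {0} = 1 + sqrt (2 * (1 - ?P {0}))"
    by (rule trace_norm_ptrans_bounds(1,3)[OF bijA assms, where \<phi> = "\<lambda>x y. \<psi> $ (x * (dB * dC) + y)"];
      simp add: mix_0)+
  have C: "?P {0, 1} \<le> 1" "1 + sqrt (2 * (1 - ?P {0, 1})) \<le> ?T {0, 1}"
    by (rule trace_norm_ptrans_bounds(1,2)[OF bijC assms, where \<phi> = "\<lambda>x y. \<psi> $ (x * dC + y)"];
      simp only: mix_01)+
  have B: "?P {0, 2} \<le> 1" "1 + sqrt (2 * (1 - ?P {0, 2})) \<le> ?T {0, 2}"
    by (rule trace_norm_ptrans_bounds(1,2)[OF bijB assms, where \<phi> = "\<lambda>x y. \<psi> $ g x y"];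
      simp only: mix_02)+
  define b c where "b = sqrt (2 * (1 - ?P {0, 2}))" and "c = sqrt (2 * (1 - ?P {0, 1}))"
  have ge: "1 + b \<le> ?T {0, 2}" "1 + c \<le> ?T {0, 1}" unfolding b_def c_def by (fact B(2), fact C(2))
  have bc: "0 \<le> b" "0 \<le> c" using B(1) C(1) by (simp_all add: b_def c_def)
  have "sqrt (2 * (1 - ?P {0})) \<le> sqrt (2 * (1 - ?P {0, 2}) + 2 * (1 - ?P {0, 1}))"
    using swap_purity_subadditive[OF assms] by simp
  also have "\<dots> \<le> b + c"
    unfolding b_def c_def using B(1) C(1) by (intro sqrt_add_le_add_sqrt) auto
  finally have "?T {0} \<le> 1 + b + c" using A(2) by simp
  \<comment> \<open>The surplus is the nonnegative product \<open>b * c\<close>.\<close>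
  also have "\<dots> \<le> (1 + b) * (1 + c)" using bc by (simp add: algebra_simps)
  also have "\<dots> \<le> ?T {0, 2} * ?T {0, 1}"
    using ge bc by (intro mult_mono) linarith+
  finally have le: "?T {0} \<le> ?T {0, 2} * ?T {0, 1}" .
  have pos: "0 < ?T {0, 2}" "0 < ?T {0, 1}" using ge bc by linarith+
  have "0 < ?T {0}" using A by (simp add: add_pos_nonneg)
  then have "log 2 (?T {0}) \<le> log 2 (?T {0, 2} * ?T {0, 1})"
    using le pos by simp
  also have "\<dots> = log 2 (?T {0, 2}) + log 2 (?T {0, 1})" using pos by (simp add: log_mult)
  finally show ?thesis unfolding log_neg_def by simp
qed

end
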